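(* Let $D\subseteq\mathbb{R}^d$ be compact, let $\mu$ be a probability measure supported on $D$, let $1<p<\infty$, and let $d_a,d_v\ge 1$ be integers. Let $\mathcal{U}=L^p(D,\mu;\mathbb{R}^{d_v})$, in which the continuous functions $C(D;\mathbb{R}^{d_v})$ are dense, and let $\nu$ be a probability measure supported on $\mathcal{U}$ with $\mathbb{E}_{v\sim\nu}\|v\|_{\mathcal{U}}<\infty$. Let $a:D\to\mathbb{R}^{d_a}$ be a given input function, belonging to a separable Banach space $\mathcal{A}(D;\mathbb{R}^{d_a})$ of functions on $D$ with values in $\mathbb{R}^{d_a}$. Then for every $v\in\mathcal{U}$ and every $\epsilon>0$ there exists a neural network $h_\eta:\mathbb{R}^d\times\mathbb{R}^d\times\mathbb{R}^{d_a}\to\mathbb{R}^{d_v}$ such that the function $$\hat v(x)=\int_D h_\eta\bigl(x-y,\,x,\,a(y)\bigr)\,v(y)\,d\mu(y),\qquad x\in D,$$ where the product of the two $\mathbb{R}^{d_v}$-valued factors in the integrand is taken componentwise, satisfies $\|\hat v-v\|_{\mathcal{U}}\le\epsilon$.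
   Context: A neural network means a multi-layer feed-forward network (finite composition of affine maps and componentwise application of activation functions, ending with an affine map) whose activation functions are of the Tauber-Wiener class. A function $\sigma:\mathbb{R}\to\mathbb{R}$ is of the Tauber-Wiener class if, for every compact interval $[\alpha,\beta]\subset\mathbb{R}$, the set of finite linear combinations $\sum_{i=1}^N c_i\,\sigma(\lambda_i t+\theta_i)$ with $c_i,\lambda_i,\theta_i\in\mathbb{R}$ is dense in $C([\alpha,\beta])$ in the supremum norm. The theorem asserts the existence of such a network; it may depend on $v$ and $\epsilon$. The subscript $\eta$ denotes the parameters of the network. The norm of $\mathcal{U}$ is $\|v\|_{\mathcal{U}}=\left(\int_D |v(x)|^p\,d\mu(x)\right)^{1/p}$, with $|\cdot|$ the Euclidean norm on $\mathbb{R}^{d_v}$. *)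

theory Defs
  imports "HOL-Probability.Probability"
begin

text \<open>
  As usual for this class, \<open>\<sigma>\<close> need not be continuous, so density means that
  every continuous function is a uniform limit of the given linear combinations.
\<close>

definition tauber_wiener :: "(real \<Rightarrow> real) \<Rightarrow> bool" where
  "tauber_wiener \<sigma> \<longleftrightarrow>
    (\<forall>\<alpha> \<beta> f \<epsilon>. continuous_on {\<alpha>..\<beta>} f \<and> \<epsilon> > 0 \<longrightarrow>
      (\<exists>(N::nat) c l \<theta>. \<forall>t\<in>{\<alpha>..\<beta>}. \<bar>f t - (\<Sum>i<N. c i * \<sigma> (l i * t + \<theta> i))\<bar> < \<epsilon>))"

text \<open>
  Hidden layers have arbitrary widths, so they cannot be vectors indexed by a type.
  In \<open>tw_hidden n g\<close>, the values \<open>g z i\<close> with \<open>i < n\<close> are the outputs of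
  the \<open>n\<close> neurons of the last hidden layer on input \<open>z\<close>; the values with \<open>i \<ge> n\<close>
  are never used. Each layer may have its own activation function, and a network has at
  least one hidden layer.
\<close>

inductive tw_hidden :: "nat \<Rightarrow> ('z::euclidean_space \<Rightarrow> nat \<Rightarrow> real) \<Rightarrow> bool" where
  first: "tauber_wiener \<sigma> \<Longrightarrow> tw_hidden n (\<lambda>z i. \<sigma> (w i \<bullet> z + b i))"
| step: "tw_hidden m g \<Longrightarrow> tauber_wiener \<sigma> \<Longrightarrow>
    tw_hidden n (\<lambda>z i. \<sigma> ((\<Sum>j<m. W i j * g z j) + b i))"

definition tw_network :: "('z::euclidean_space \<Rightarrow> real ^ 'k) \<Rightarrow> bool" where
  "tw_network h \<longleftrightarrow>
    (\<exists>n g W b. tw_hidden n g \<and> h = (\<lambda>z. \<chi> k. (\<Sum>j<n. W k j * g z j) + b k))"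

text \<open>
  Functions on \<open>D\<close> are represented by total functions whose values outside \<open>D\<close> are
  irrelevant. \<open>Lp_fun \<mu> D p\<close> consists of functions, not of classes modulo null sets, so
  \<open>Lp_norm \<mu> D p\<close> is a seminorm on it.
\<close>

definition Lp_fun ::
  "'x measure \<Rightarrow> 'x set \<Rightarrow> real \<Rightarrow> ('x \<Rightarrow> 'b::euclidean_space) set" where
  "Lp_fun \<mu> D p = {v. set_borel_measurable \<mu> D v \<and> set_integrable \<mu> D (\<lambda>x. norm (v x) powr p)}"

definition Lp_norm ::
  "'x measure \<Rightarrow> 'x set \<Rightarrow> real \<Rightarrow> ('x \<Rightarrow> 'b::euclidean_space) \<Rightarrow> real" where
  "Lp_norm \<mu> D p v = (LINT x:D|\<mu>. norm (v x) powr p) powr (1 / p)"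

text \<open>
  The sets open for the \<open>L\<^sup>p\<close> seminorm are exactly the preimages of the open sets of the
  quotient Banach space, so this is the Borel \<open>\<sigma>\<close>-algebra of that space.
\<close>

definition Lp_borel ::
  "'x measure \<Rightarrow> 'x set \<Rightarrow> real \<Rightarrow> ('x \<Rightarrow> 'b::euclidean_space) measure" where
  "Lp_borel \<mu> D p = sigma (Lp_fun \<mu> D p)
    {S. S \<subseteq> Lp_fun \<mu> D p \<and>
        (\<forall>v\<in>S. \<exists>r>0. \<forall>w\<in>Lp_fun \<mu> D p. Lp_norm \<mu> D p (\<lambda>x. w x - v x) < r \<longrightarrow> w \<in> S)}"

text \<open>
  A vector space \<open>A\<close> of functions on \<open>D\<close> with norm \<open>N\<close>. Only a seminorm is required,
  elements at distance \<open>0\<close> being identified, so that spaces such as \<open>L\<^sup>q\<close> are covered as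
  well as genuinely normed spaces such as \<open>C(D)\<close>. The second condition makes \<open>A\<close> and \<open>N\<close>
  independent of values outside \<open>D\<close>.
\<close>

definition separable_banach_fun_space ::
  "'x set \<Rightarrow> ('x \<Rightarrow> 'b::real_normed_vector) set \<Rightarrow> (('x \<Rightarrow> 'b) \<Rightarrow> real) \<Rightarrow> bool" where
  "separable_banach_fun_space D A N \<longleftrightarrow>
    (\<lambda>x. 0) \<in> A \<and>
    (\<forall>f\<in>A. \<forall>g. (\<forall>x\<in>D. g x = f x) \<longrightarrow> g \<in> A \<and> N g = N f) \<and>
    (\<forall>f\<in>A. \<forall>g\<in>A. (\<lambda>x. f x + g x) \<in> A \<and> N (\<lambda>x. f x + g x) \<le> N f + N g) \<and>
    (\<forall>f\<in>A. \<forall>c. (\<lambda>x. c *\<^sub>R f x) \<in> A \<and> N (\<lambda>x. c *\<^sub>R f x) = \<bar>c\<bar> * N f) \<and>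
    (\<forall>X::nat \<Rightarrow> _. (\<forall>n. X n \<in> A) \<and>
        (\<forall>e>0. \<exists>M. \<forall>m\<ge>M. \<forall>n\<ge>M. N (\<lambda>x. X m x - X n x) < e) \<longrightarrow>
        (\<exists>f\<in>A. (\<lambda>n. N (\<lambda>x. X n x - f x)) \<longlonglongrightarrow> 0)) \<and>
    (\<exists>C. countable C \<and> C \<subseteq> A \<and> (\<forall>f\<in>A. \<forall>e>0. \<exists>g\<in>C. N (\<lambda>x. f x - g x) < e))"

definition kernel_integrand ::
  "((real^'d) \<times> (real^'d) \<times> (real^'a) \<Rightarrow> real^'v) \<Rightarrow> (real^'d \<Rightarrow> real^'a) \<Rightarrow>
   (real^'d \<Rightarrow> real^'v) \<Rightarrow> real^'d \<Rightarrow> real^'d \<Rightarrow> real^'v" where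
  "kernel_integrand h a v x y = (\<chi> k. h (x - y, x, a y) $ k * v y $ k)"

definition kernel_operator ::
  "(real^'d) measure \<Rightarrow> (real^'d) set \<Rightarrow>
   ((real^'d) \<times> (real^'d) \<times> (real^'a) \<Rightarrow> real^'v) \<Rightarrow> (real^'d \<Rightarrow> real^'a) \<Rightarrow>
   (real^'d \<Rightarrow> real^'v) \<Rightarrow> real^'d \<Rightarrow> real^'v" where
  "kernel_operator \<mu> D h a v x = (LINT y:D|\<mu>. kernel_integrand h a v x y)"

end

theory Submission
  imports Defs
begin

text \<open>
  Linear combinations of \<open>\<lambda>z. sin (w \<bullet> z + b)\<close> form an algebra that separates points, so by
  Stone--Weierstrass \<open>sin\<close> is of the Tauber--Wiener class and one-hidden-layer sine networks are
  dense in \<open>L\<^sup>p\<close>. The network is free to ignore \<open>a y\<close>, and since \<open>y = x - (x - y)\<close> its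
  \<open>k\<close>-th component may be a separable kernel \<open>\<psi>\<^sub>k(x) \<phi>\<^sub>k(y)\<close>, which is again a sine network because
  products of sines are sums of sines. The operator then returns \<open>\<psi>\<^sub>k(x) \<integral> \<phi>\<^sub>k v\<^sub>k d\<mu>\<close>: unless
  \<open>v\<^sub>k = 0\<close> almost everywhere, take \<open>\<phi>\<^sub>k\<close> with nonzero integral against \<open>v\<^sub>k\<close> and then
  \<open>\<psi>\<^sub>k\<close> approximating \<open>v\<^sub>k\<close> divided by that integral.
\<close>

section \<open>Shallow sine networks\<close>

text \<open>The vector coefficient lets one predicate serve both the scalar functions and the
  vector-valued network. Neurons and sums suffice: a constant is a neuron with weight
  \<open>0\<close> and bias \<open>pi / 2\<close>, and scalar factors go into
  \<open>c\<close>.\<close>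

inductive sin_net :: "('z::euclidean_space \<Rightarrow> 'b::real_normed_vector) \<Rightarrow> bool" where
  neuron: "sin_net (\<lambda>z. sin (w \<bullet> z + b) *\<^sub>R c)"
| add: "sin_net f \<Longrightarrow> sin_net g \<Longrightarrow> sin_net (\<lambda>z. f z + g z)"

lemma sin_net_const: "sin_net (\<lambda>z. c)"
  using sin_net.neuron[of 0 "pi / 2" c] by simp

lemma sin_net_scaleR_const:
  assumes "sin_net f"
  shows "sin_net (\<lambda>z. f z *\<^sub>R c)"
  using assms
proof induction
  case (neuron w b d)
  then show ?case using sin_net.neuron[of w b "d *\<^sub>R c"] by simp
next
  case (add f g)
  then show ?case using sin_net.add by (simp add: scaleR_add_left)
qed

lemma sin_net_cmult:
  fixes f :: "'z::euclidean_space \<Rightarrow> real"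
  assumes "sin_net f"
  shows "sin_net (\<lambda>z. c * f z)"
  using sin_net_scaleR_const[OF assms, of c] by (simp add: mult.commute)

text \<open>Product-to-sum: sin s * sin t = (cos (s - t) - cos (s + t)) / 2, and each cosine is a
  sine with bias shifted by \<open>pi / 2\<close>. This makes the scalar sine networks an algebra,
  as Stone-Weierstrass and product kernels require.\<close>

lemma sin_net_mult:
  fixes f g :: "'z::euclidean_space \<Rightarrow> real"
  assumes "sin_net f" "sin_net g"
  shows "sin_net (\<lambda>z. f z * g z)"
  using assms(1)
proof induction
  case (neuron w b c)
  show ?case using assms(2)
  proof induction
    case (neuron w' b' c')
    have "(\<lambda>z. (sin (w \<bullet> z + b) *\<^sub>R c) * (sin (w' \<bullet> z + b') *\<^sub>R c')) =
      (\<lambda>z. sin ((w - w') \<bullet> z + (b - b' + pi / 2)) *\<^sub>R (c * c' / 2) +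
           sin ((w + w') \<bullet> z + (b + b' + pi / 2)) *\<^sub>R (- (c * c' / 2)))"
    proof
      fix z
      have "(w - w') \<bullet> z + (b - b' + pi / 2) = ((w \<bullet> z + b) - (w' \<bullet> z + b')) + pi / 2"
        "(w + w') \<bullet> z + (b + b' + pi / 2) = ((w \<bullet> z + b) + (w' \<bullet> z + b')) + pi / 2"
        by (simp_all add: inner_simps)
      moreover have shift: "sin (r + pi / 2) = cos r" for r :: real
        by (simp add: sin_add)
      have "(sin s *\<^sub>R c) * (sin t *\<^sub>R c') =
          sin ((s - t) + pi / 2) *\<^sub>R (c * c' / 2) + sin ((s + t) + pi / 2) *\<^sub>R (- (c * c' / 2))"
        for s t :: real
        unfolding shift cos_diff cos_add by (simp add: algebra_simps)
      ultimately show "(sin (w \<bullet> z + b) *\<^sub>R c) * (sin (w' \<bullet> z + b') *\<^sub>R c') =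
          sin ((w - w') \<bullet> z + (b - b' + pi / 2)) *\<^sub>R (c * c' / 2) +
          sin ((w + w') \<bullet> z + (b + b' + pi / 2)) *\<^sub>R (- (c * c' / 2))"
        by (simp only:)
    qed
    then show ?case by (simp only: sin_net.intros)
  next
    case (add f g)
    then show ?case using sin_net.add by (simp only: distrib_left)
  qed
next
  case (add f g)
  then show ?case using sin_net.add by (simp only: distrib_right)
qed

lemma sin_net_sum:
  assumes "finite I" "\<And>i. i \<in> I \<Longrightarrow> sin_net (f i)"
  shows "sin_net (\<lambda>z. \<Sum>i\<in>I. f i z)"
  using assms by (induction I) (auto intro: sin_net_const sin_net.add)

text \<open>The adjoint of \<open>L\<close> acts on the weights. This allows networks in x or in y
  to be read as networks in the triple (x - y, x, a y).\<close>

lemma sin_net_compose_linear: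
  assumes "sin_net f" "linear L"
  shows "sin_net (\<lambda>z. f (L z))"
  using assms(1)
proof induction
  case (neuron w b c)
  have "w \<bullet> L z = adjoint L w \<bullet> z" for z
    using adjoint_works[OF assms(2), of z w] by (simp add: inner_commute)
  then show ?case by (simp add: sin_net.neuron)
qed (rule sin_net.add)

section \<open>Continuity, boundedness and uniform density of sine networks\<close>

lemma sin_net_continuous:
  assumes "sin_net f"
  shows "continuous_on UNIV f"
  using assms by induction (intro continuous_intros; assumption)+

lemma sin_net_borel_measurable:
  fixes f :: "'z::euclidean_space \<Rightarrow> 'b::euclidean_space"
  assumes "sin_net f"
  shows "f \<in> borel_measurable borel"
  using assms by (intro borel_measurable_continuous_onI sin_net_continuous)

lemma sin_net_bounded:
  assumes "sin_net f"
  obtains B where "B \<ge> 0" "\<And>z. norm (f z) \<le> B"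
proof -
  from assms have "\<exists>B\<ge>0. \<forall>z. norm (f z) \<le> B"
  proof induction
    case (neuron w b c)
    have "\<bar>sin (w \<bullet> z + b)\<bar> * norm c \<le> norm c" for z
      using mult_right_mono[OF abs_sin_le_one, of "norm c"] by simp
    then show ?case by (intro exI[of _ "norm c"]) auto
  next
    case (add f g)
    then obtain B C where "B \<ge> 0" "C \<ge> 0" "\<forall>z. norm (f z) \<le> B" "\<forall>z. norm (g z) \<le> C"
      by blast
    then show ?case
      by (intro exI[of _ "B + C"]) (auto intro!: norm_triangle_mono)
  qed
  then show ?thesis using that by blast
qed

lemma sin_net_dense:
  fixes f :: "'z::euclidean_space \<Rightarrow> real"
  assumes "compact S" "continuous_on S f" "e > 0"
  obtains g where "sin_net g" "\<And>x. x \<in> S \<Longrightarrow> \<bar>f x - g x\<bar> < e"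
proof -
  have sep: "\<exists>f. sin_net f \<and> f x \<noteq> (f y :: real)" if "x \<noteq> y" for x y :: 'z
  proof -
    \<comment> \<open>The scaling gives \<open>w\<close> inner product 1 with x - y, so the neuron
      with bias \<open>- (w \<bullet> y)\<close> takes the value 0 at y and sin 1 at x.\<close>
    define w where "w = (x - y) /\<^sub>R ((x - y) \<bullet> (x - y))"
    have "w \<bullet> x + - (w \<bullet> y) = 1"
      using that inner_eq_zero_iff[of "x - y"] unfolding w_def
      by (simp add: inverse_eq_divide flip: inner_diff_right diff_divide_distrib)
    moreover have "sin (1::real) \<noteq> 0"
      using sin_gt_zero[of 1] pi_gt3 by simp
    ultimately show ?thesis
      by (intro exI[of _ "\<lambda>z. sin (w \<bullet> z + - (w \<bullet> y)) *\<^sub>R (1::real)"] conjI sin_net.neuron) auto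
  qed
  have "\<exists>g. sin_net g \<and> (\<forall>x\<in>S. \<bar>f x - g x\<bar> < e)"
  proof (rule Stone_Weierstrass_HOL[where P = sin_net, OF assms(1)])
    show "continuous_on S g" if "sin_net g" for g :: "'z \<Rightarrow> real"
      using sin_net_continuous[OF that] by (rule continuous_on_subset) simp
  qed (use assms sep in \<open>auto intro: sin_net_const sin_net.add sin_net_mult\<close>)
  then show ?thesis using that by blast
qed

text \<open>Turns the inductive description into the indexed sums in which
  \<open>tauber_wiener\<close> and \<open>tw_hidden\<close> are phrased.\<close>

lemma sin_net_expansion:
  assumes "sin_net f"
  obtains n c w b where "f = (\<lambda>z. \<Sum>i<(n::nat). sin (w i \<bullet> z + b i) *\<^sub>R c i)"
proof -
  from assms have "\<exists>(n::nat) c w b. f = (\<lambda>z. \<Sum>i<n. sin (w i \<bullet> z + b i) *\<^sub>R c i)"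
  proof induction
    case (neuron w b c)
    show ?case
      by (intro exI[of _ 1] exI[of _ "\<lambda>_. c"] exI[of _ "\<lambda>_. w"] exI[of _ "\<lambda>_. b"]) simp
  next
    case (add f g)
    then obtain n c w b n' c' w' b' where
      f: "f = (\<lambda>z. \<Sum>i<(n::nat). sin (w i \<bullet> z + b i) *\<^sub>R c i)" and
      g: "g = (\<lambda>z. \<Sum>i<(n'::nat). sin (w' i \<bullet> z + b' i) *\<^sub>R c' i)"
      by blast
    \<comment> \<open>Concatenation of two families: the first \<open>n\<close> indices belong to
      \<open>f\<close>, and those from \<open>n\<close> on, shifted back by \<open>n\<close>, belong
      to \<open>g\<close>.\<close>
    let ?j = "\<lambda>u u' i. if i < n then u i else u' (i - n)"
    have "(\<Sum>i<n + n'. sin (?j w w' i \<bullet> z + ?j b b' i) *\<^sub>R ?j c c' i) = f z + g z" for z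
    proof -
      have "(\<Sum>i<n + n'. h i) = (\<Sum>i<n. h i) + (\<Sum>i<n'. h (n + i))" for h :: "nat \<Rightarrow> 'b"
        by (induction n') (simp_all add: add.assoc)
      then show ?thesis by (simp add: f g)
    qed
    then show ?case
      by (intro exI[of _ "n + n'"] exI[of _ "?j c c'"] exI[of _ "?j w w'"] exI[of _ "?j b b'"])
        (simp add: fun_eq_iff)
  qed
  then show ?thesis using that by blast
qed

text \<open>This is \<open>sin_net_dense\<close> on the real line, where the inner product is
  multiplication.\<close>

lemma tauber_wiener_sin: "tauber_wiener sin"
  unfolding tauber_wiener_def
proof (intro allI impI, elim conjE)
  fix \<alpha> \<beta> \<epsilon> :: real and f :: "real \<Rightarrow> real"
  assume "continuous_on {\<alpha>..\<beta>} f" "\<epsilon> > 0"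
  then obtain g where g: "sin_net g" "\<And>t. t \<in> {\<alpha>..\<beta>} \<Longrightarrow> \<bar>f t - g t\<bar> < \<epsilon>"
    using sin_net_dense[OF compact_Icc] by blast
  obtain n c l \<theta> where "g = (\<lambda>t. \<Sum>i<(n::nat). sin (l i \<bullet> t + \<theta> i) *\<^sub>R c i)"
    using sin_net_expansion[OF g(1)] .
  then have "g t = (\<Sum>i<n. c i * sin (l i * t + \<theta> i))" for t
    by (simp add: mult.commute)
  then show "\<exists>(N::nat) c l \<theta>. \<forall>t\<in>{\<alpha>..\<beta>}. \<bar>f t - (\<Sum>i<N. c i * sin (l i * t + \<theta> i))\<bar> < \<epsilon>"
    using g(2) by (intro exI[of _ n] exI[of _ c] exI[of _ l] exI[of _ \<theta>]) simp
qed

text \<open>One hidden layer suffices: the neurons form the layer, and the components of the vector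
  coefficients are the output weights, with zero output bias.\<close>

lemma tw_network_sin_net:
  fixes h :: "'z::euclidean_space \<Rightarrow> real ^ 'k"
  assumes "sin_net h"
  shows "tw_network h"
proof -
  obtain n c w b where h: "h = (\<lambda>z. \<Sum>i<(n::nat). sin (w i \<bullet> z + b i) *\<^sub>R c i)"
    using sin_net_expansion[OF assms] .
  have "tw_hidden n (\<lambda>z i. sin (w i \<bullet> z + b i))"
    by (rule tw_hidden.first[OF tauber_wiener_sin])
  moreover have "h = (\<lambda>z. \<chi> k. (\<Sum>j<n. c j $ k * sin (w j \<bullet> z + b j)) + 0)"
    by (simp add: h fun_eq_iff vec_eq_iff mult.commute)
  ultimately show ?thesis
    unfolding tw_network_def
    by (intro exI[of _ n] exI[of _ "\<lambda>z i. sin (w i \<bullet> z + b i)"] exI[of _ "\<lambda>k j. c j $ k"]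
        exI[of _ "\<lambda>_. 0"]) simp
qed

section \<open>Density in \<open>L\<^sup>p\<close>\<close>

text \<open>A crude substitute for the Minkowski inequality: the norm of a sum is at most twice the
  larger norm. The factor \<open>2 powr p\<close> is harmless, since the errors added can be made
  arbitrarily small.\<close>

lemma norm_add_powr_le:
  fixes a b :: "'b::real_normed_vector"
  assumes "p \<ge> 0"
  shows "norm (a + b) powr p \<le> 2 powr p * (norm a powr p + norm b powr p)"
proof -
  have "norm (a + b) powr p \<le> (2 * max (norm a) (norm b)) powr p"
    using norm_triangle_ineq[of a b] assms by (intro powr_mono2) auto
  also have "\<dots> = 2 powr p * max (norm a) (norm b) powr p"
    by (subst powr_mult) auto
  also have "max (norm a) (norm b) powr p \<le> norm a powr p + norm b powr p"
    by (auto simp: max_def)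
  finally show ?thesis by (simp add: mult_left_mono)
qed

lemma integral_abs_add_powr_le:
  fixes f g :: "'x \<Rightarrow> real"
  assumes [measurable]: "f \<in> borel_measurable M" "g \<in> borel_measurable M"
    and "integrable M (\<lambda>x. \<bar>f x\<bar> powr p)" "integrable M (\<lambda>x. \<bar>g x\<bar> powr p)" "p \<ge> 0"
  shows "integrable M (\<lambda>x. \<bar>f x + g x\<bar> powr p)"
    and "(LINT x|M. \<bar>f x + g x\<bar> powr p)
      \<le> 2 powr p * ((LINT x|M. \<bar>f x\<bar> powr p) + (LINT x|M. \<bar>g x\<bar> powr p))"
proof -
  have int: "integrable M (\<lambda>x. 2 powr p * (\<bar>f x\<bar> powr p + \<bar>g x\<bar> powr p))"
    using assms by simp
  have le: "\<bar>f x + g x\<bar> powr p \<le> 2 powr p * (\<bar>f x\<bar> powr p + \<bar>g x\<bar> powr p)" for x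
    using norm_add_powr_le[OF \<open>p \<ge> 0\<close>, of "f x" "g x"] by simp
  show i: "integrable M (\<lambda>x. \<bar>f x + g x\<bar> powr p)"
    by (rule Bochner_Integration.integrable_bound[OF int])
      (use le in \<open>auto intro!: AE_I2 order.trans[OF le abs_ge_self]\<close>)
  have "(LINT x|M. \<bar>f x + g x\<bar> powr p) \<le> (LINT x|M. 2 powr p * (\<bar>f x\<bar> powr p + \<bar>g x\<bar> powr p))"
    by (rule integral_mono[OF i int le])
  then show "(LINT x|M. \<bar>f x + g x\<bar> powr p)
      \<le> 2 powr p * ((LINT x|M. \<bar>f x\<bar> powr p) + (LINT x|M. \<bar>g x\<bar> powr p))"
    using assms by simp
qed

text \<open>Closeness in \<open>L^p\<close>, measured by the p-th power of the distance to avoid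
  roots. Integrability is demanded explicitly because a non-integrable function has Bochner integral
  0, so a small integral alone would say nothing.\<close>

definition sin_approx :: "'z::euclidean_space measure \<Rightarrow> real \<Rightarrow> ('z \<Rightarrow> real) \<Rightarrow> bool" where
  "sin_approx M p f \<longleftrightarrow> (\<forall>e>0. \<exists>s. sin_net s \<and>
    integrable M (\<lambda>x. \<bar>f x - s x\<bar> powr p) \<and> (LINT x|M. \<bar>f x - s x\<bar> powr p) < e)"

text \<open>The approximable functions are closed under \<open>L^p\<close> limits, which lets
  density climb from continuous functions to indicators and then to monotone limits.\<close>

lemma sin_approx_limit:
  assumes sets: "sets M = sets borel" and "p \<ge> 0" and f: "f \<in> borel_measurable M"
    and lim: "\<And>e. e > 0 \<Longrightarrow> \<exists>g. g \<in> borel_measurable M \<and> sin_approx M p g \<and>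
      integrable M (\<lambda>x. \<bar>f x - g x\<bar> powr p) \<and> (LINT x|M. \<bar>f x - g x\<bar> powr p) < e"
  shows "sin_approx M p f"
  unfolding sin_approx_def
proof (intro allI impI)
  fix e :: real assume "e > 0"
  \<comment> \<open>Two errors below \<open>d\<close>, multiplied by the factor
    \<open>2 powr p\<close> of the quasi-triangle inequality, add up to less than
    \<open>e\<close>.\<close>
  define d where "d = e / (2 * 2 powr p)"
  have "d > 0" using \<open>e > 0\<close> by (simp add: d_def)
  obtain g where g: "g \<in> borel_measurable M" "sin_approx M p g"
    "integrable M (\<lambda>x. \<bar>f x - g x\<bar> powr p)" "(LINT x|M. \<bar>f x - g x\<bar> powr p) < d"
    using lim[OF \<open>d > 0\<close>] by blast
  obtain s where s: "sin_net s" "integrable M (\<lambda>x. \<bar>g x - s x\<bar> powr p)"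
    "(LINT x|M. \<bar>g x - s x\<bar> powr p) < d"
    using g(2) \<open>d > 0\<close> unfolding sin_approx_def by blast
  have sm: "s \<in> borel_measurable M"
    using sin_net_borel_measurable[OF s(1)] by (simp add: measurable_cong_sets[OF sets refl])
  note * = integral_abs_add_powr_le[OF borel_measurable_diff[OF f g(1)]
      borel_measurable_diff[OF g(1) sm] g(3) s(2) \<open>p \<ge> 0\<close>, simplified]
  have "2 powr p * ((LINT x|M. \<bar>f x - g x\<bar> powr p) + (LINT x|M. \<bar>g x - s x\<bar> powr p))
      < 2 powr p * (d + d)"
    using g(4) s(3) by (intro mult_strict_left_mono add_strict_mono) auto
  also have "\<dots> = e" by (simp add: d_def)
  finally show "\<exists>s. sin_net s \<and> integrable M (\<lambda>x. \<bar>f x - s x\<bar> powr p) \<and>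
      (LINT x|M. \<bar>f x - s x\<bar> powr p) < e"
    using s(1) * by (intro exI[of _ s]) auto
qed

lemma sin_approx_cmult:
  assumes "sin_approx M p f"
  shows "sin_approx M p (\<lambda>x. c * f x)"
  unfolding sin_approx_def
proof (intro allI impI)
  fix e :: real assume "e > 0"
  \<comment> \<open>The summand 1 keeps the denominator positive when \<open>c = 0\<close> and makes
    the final bound strict.\<close>
  define d where "d = e / (\<bar>c\<bar> powr p + 1)"
  have "\<bar>c\<bar> powr p + 1 > 0" by (smt (verit) powr_ge_zero)
  then have "d > 0" using \<open>e > 0\<close> by (simp add: d_def)
  obtain s where s: "sin_net s" "integrable M (\<lambda>x. \<bar>f x - s x\<bar> powr p)"
    "(LINT x|M. \<bar>f x - s x\<bar> powr p) < d"
    using assms \<open>d > 0\<close> unfolding sin_approx_def by blast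
  have eq: "\<bar>c * f x - c * s x\<bar> powr p = \<bar>c\<bar> powr p * \<bar>f x - s x\<bar> powr p" for x
    by (simp add: abs_mult powr_mult flip: right_diff_distrib)
  have "\<bar>c\<bar> powr p * (LINT x|M. \<bar>f x - s x\<bar> powr p) \<le> \<bar>c\<bar> powr p * d"
    using s(3) by (intro mult_left_mono) auto
  also have "\<dots> < e"
    using \<open>e > 0\<close> \<open>\<bar>c\<bar> powr p + 1 > 0\<close> by (simp add: d_def field_simps)
  finally show "\<exists>s. sin_net s \<and> integrable M (\<lambda>x. \<bar>c * f x - s x\<bar> powr p) \<and>
      (LINT x|M. \<bar>c * f x - s x\<bar> powr p) < e"
    using s sin_net_cmult[OF s(1), of c]
    by (intro exI[of _ "\<lambda>x. c * s x"]) (simp add: eq)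
qed

lemma sin_approx_add:
  assumes sets: "sets M = sets borel" and "p \<ge> 0"
    and f: "f \<in> borel_measurable M" "sin_approx M p f"
    and g: "g \<in> borel_measurable M" "sin_approx M p g"
  shows "sin_approx M p (\<lambda>x. f x + g x)"
  unfolding sin_approx_def
proof (intro allI impI)
  fix e :: real assume "e > 0"
  define d where "d = e / (2 * 2 powr p)"
  have "d > 0" using \<open>e > 0\<close> by (simp add: d_def)
  obtain s where s: "sin_net s" "integrable M (\<lambda>x. \<bar>f x - s x\<bar> powr p)"
    "(LINT x|M. \<bar>f x - s x\<bar> powr p) < d"
    using f(2) \<open>d > 0\<close> unfolding sin_approx_def by blast
  obtain t where t: "sin_net t" "integrable M (\<lambda>x. \<bar>g x - t x\<bar> powr p)"
    "(LINT x|M. \<bar>g x - t x\<bar> powr p) < d"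
    using g(2) \<open>d > 0\<close> unfolding sin_approx_def by blast
  have [measurable]: "s \<in> borel_measurable M" "t \<in> borel_measurable M"
    using sin_net_borel_measurable[OF s(1)] sin_net_borel_measurable[OF t(1)]
    by (simp_all add: measurable_cong_sets[OF sets refl])
  note [measurable] = f(1) g(1)
  have m: "(\<lambda>x. f x - s x) \<in> borel_measurable M" "(\<lambda>x. g x - t x) \<in> borel_measurable M"
    by measurable
  have eq: "f x - s x + (g x - t x) = f x + g x - (s x + t x)" for x
    by simp
  note * = integral_abs_add_powr_le[OF m s(2) t(2) \<open>p \<ge> 0\<close>, unfolded eq]
  have "2 powr p * ((LINT x|M. \<bar>f x - s x\<bar> powr p) + (LINT x|M. \<bar>g x - t x\<bar> powr p))
      < 2 powr p * (d + d)"
    using s(3) t(3) by (intro mult_strict_left_mono add_strict_mono) auto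
  also have "\<dots> = e" by (simp add: d_def)
  finally show "\<exists>s. sin_net s \<and> integrable M (\<lambda>x. \<bar>f x + g x - s x\<bar> powr p) \<and>
      (LINT x|M. \<bar>f x + g x - s x\<bar> powr p) < e"
    using sin_net.add[OF s(1) t(1)] * by (intro exI[of _ "\<lambda>x. s x + t x"]) auto
qed

text \<open>Uniform approximation on \<open>D\<close> is enough, because the complement of
  \<open>D\<close> is null and the measure is finite.\<close>

lemma sin_approx_continuous:
  assumes sets: "sets M = sets borel" and "finite_measure M" and "p > 0"
    and D: "compact D" "AE x in M. x \<in> D" and f: "continuous_on UNIV f"
  shows "sin_approx M p f"
  unfolding sin_approx_def
proof (intro allI impI)
  fix e :: real assume "e > 0"
  interpret finite_measure M by fact
  \<comment> \<open>Chosen so that \<open>d powr p\<close> times the total mass stays strictly below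
    \<open>e\<close>, even for the zero measure.\<close>
  define d where "d = (e / (measure M (space M) + 1)) powr (1 / p)"
  have pos: "measure M (space M) + 1 > 0" by (smt (verit) measure_nonneg)
  have "d > 0" using \<open>e > 0\<close> pos by (simp add: d_def)
  obtain s where s: "sin_net s" "\<And>x. x \<in> D \<Longrightarrow> \<bar>f x - s x\<bar> < d"
    using sin_net_dense[OF D(1) continuous_on_subset[OF f] \<open>d > 0\<close>] by auto
  have [measurable]: "s \<in> borel_measurable M" "f \<in> borel_measurable M"
    using sin_net_borel_measurable[OF s(1)] borel_measurable_continuous_onI[OF f]
    by (simp_all add: measurable_cong_sets[OF sets refl])
  have le: "AE x in M. \<bar>f x - s x\<bar> powr p \<le> d powr p"
    using D(2) by eventually_elim (use s(2) \<open>p > 0\<close> in \<open>auto intro!: powr_mono2 intro: less_imp_le\<close>)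
  have int: "integrable M (\<lambda>x. \<bar>f x - s x\<bar> powr p)"
    by (rule integrable_const_bound[where B = "d powr p"]) (use le in auto)
  have "(LINT x|M. \<bar>f x - s x\<bar> powr p) \<le> (LINT x|M. d powr p)"
    by (rule integral_mono_AE[OF int _ le]) auto
  also have "\<dots> = e / (measure M (space M) + 1) * measure M (space M)"
    using \<open>p > 0\<close> \<open>e > 0\<close> pos by (simp add: d_def powr_powr)
  also have "\<dots> < e"
    using \<open>e > 0\<close> pos by (simp add: field_simps)
  finally show "\<exists>s. sin_net s \<and> integrable M (\<lambda>x. \<bar>f x - s x\<bar> powr p) \<and>
      (LINT x|M. \<bar>f x - s x\<bar> powr p) < e"
    using s(1) int by blast
qed

lemma inner_regular_compact:
  fixes B :: "'a::{second_countable_topology, complete_space} set"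
  assumes "finite_measure M" and sets: "sets M = sets borel" and B: "B \<in> sets borel" and "e > 0"
  obtains K where "K \<subseteq> B" "compact K" "measure M (B - K) < e"
proof -
  interpret finite_measure M by fact
  have "\<exists>K. K \<subseteq> B \<and> compact K \<and> measure M B - e < measure M K"
  \<comment> \<open>In the first case the empty set works. In the second the difference is
    nonnegative, so passing to \<open>ennreal\<close> truncates nothing.\<close>
  proof (cases "measure M B < e")
    case True
    then show ?thesis by (intro exI[of _ "{}"]) simp
  next
    case False
    then have "ennreal (measure M B - e) < emeasure M B"
      using \<open>e > 0\<close> by (simp add: emeasure_eq_measure ennreal_less_iff)
    also have "emeasure M B = (SUP K \<in> {K. K \<subseteq> B \<and> compact K}. emeasure M K)"
      by (intro inner_regular sets B) simp
    finally obtain K where "K \<subseteq> B" "compact K" "ennreal (measure M B - e) < emeasure M K"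
      by (auto simp: less_SUP_iff)
    then show ?thesis
      using False by (auto simp: emeasure_eq_measure ennreal_less_iff)
  qed
  then obtain K where K: "K \<subseteq> B" "compact K" "measure M B - e < measure M K"
    by blast
  have "measure M (B - K) = measure M B - measure M K"
    using K sets B by (intro finite_measure_Diff) (auto intro: borel_compact)
  then show thesis using that K by simp
qed

text \<open>With compact \<open>K\<close> inside \<open>A\<close> and \<open>L\<close> inside its
  complement, a Urysohn function equal to 1 on \<open>K\<close> and 0 on \<open>L\<close> differs
  from the indicator by at most 1, and only on the two small remainders.\<close>

lemma sin_approx_indicator:
  assumes sets: "sets M = sets borel" and "finite_measure M" and "p > 0"
    and D: "compact D" "AE x in M. x \<in> D" and A: "A \<in> sets M"
  shows "sin_approx M p (indicator A)"
proof (rule sin_approx_limit[OF sets])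
  interpret finite_measure M by fact
  fix e :: real assume "e > 0"
  obtain K where K: "K \<subseteq> A" "compact K" "measure M (A - K) < e / 2"
    using inner_regular_compact[OF \<open>finite_measure M\<close> sets, of A "e / 2"] A sets \<open>e > 0\<close> by auto
  obtain L where L: "L \<subseteq> - A" "compact L" "measure M (- A - L) < e / 2"
    using inner_regular_compact[OF \<open>finite_measure M\<close> sets, of "- A" "e / 2"] A sets \<open>e > 0\<close> by auto
  have [measurable]: "K \<in> sets M" "L \<in> sets M" "A \<in> sets M"
    using K L A sets by (auto intro: borel_compact)
  have "space M = UNIV" using sets_eq_imp_space_eq[OF sets] by simp
  then have [measurable]: "- A \<in> sets M"
    using sets.compl_sets[OF A] by (simp add: Compl_eq_Diff_UNIV)
  obtain f :: "'a \<Rightarrow> real" where f: "continuous_on UNIV f" "\<And>x. f x \<in> closed_segment 1 0"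
    "\<And>x. x \<in> K \<Longrightarrow> f x = 1" "\<And>x. x \<in> L \<Longrightarrow> f x = 0"
    using Urysohn[of K L 1 0] K L by (auto intro: compact_imp_closed)
  have f01: "0 \<le> f x" "f x \<le> 1" for x
    using f(2)[of x] by (auto simp: closed_segment_eq_real_ivl)
  have [measurable]: "f \<in> borel_measurable M"
    using borel_measurable_continuous_onI[OF f(1)] by (simp add: measurable_cong_sets[OF sets refl])
  have le: "\<bar>indicator A x - f x\<bar> powr p \<le> indicator (A - K) x + indicator (- A - L) x" for x
  proof -
    have "\<bar>indicator A x - f x\<bar> powr p \<le> 1 powr p"
      using f01[of x] \<open>p > 0\<close> by (intro powr_mono2) (auto simp: indicator_def)
    then show ?thesis
      using f(3,4)[of x] K(1) L(1) \<open>p > 0\<close> by (auto simp: indicator_def split: if_splits)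
  qed
  have int: "integrable M (\<lambda>x. indicator (A - K) x + indicator (- A - L) x :: real)"
    by (intro Bochner_Integration.integrable_add integrable_real_indicator)
      (auto simp: emeasure_eq_measure)
  have int': "integrable M (\<lambda>x. \<bar>indicator A x - f x\<bar> powr p)"
    by (rule Bochner_Integration.integrable_bound[OF int])
      (use le in \<open>auto intro!: AE_I2 order.trans[OF le abs_ge_self]\<close>)
  have "(LINT x|M. \<bar>indicator A x - f x\<bar> powr p)
      \<le> (LINT x|M. indicator (A - K) x + indicator (- A - L) x)"
    by (rule integral_mono[OF int' int le])
  also have "\<dots> = measure M (A - K) + measure M (- A - L)"
    by (subst Bochner_Integration.integral_add) (auto simp: emeasure_eq_measure)
  also have "\<dots> < e" using K(3) L(3) by simp
  finally show "\<exists>g. g \<in> borel_measurable M \<and> sin_approx M p g \<and>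
      integrable M (\<lambda>x. \<bar>indicator A x - g x\<bar> powr p) \<and>
      (LINT x|M. \<bar>indicator A x - g x\<bar> powr p) < e"
    using int' sin_approx_continuous[OF sets \<open>finite_measure M\<close> \<open>p > 0\<close> D f(1)]
    by (intro exI[of _ f]) auto
qed (use A \<open>p > 0\<close> in auto)

lemma sin_approx_nonneg:
  assumes sets: "sets M = sets borel" and "finite_measure M" and "p > 0"
    and D: "compact D" "AE x in M. x \<in> D"
    and u: "u \<in> borel_measurable M" "\<And>x. 0 \<le> u x" "integrable M (\<lambda>x. \<bar>u x\<bar> powr p)"
  shows "sin_approx M p u"
  using u
proof (induction rule: borel_measurable_induct_real)
  case (set A)
  show ?case by (rule sin_approx_indicator) fact+
next
  case (mult u c)
  show ?case
  \<comment> \<open>For \<open>c = 0\<close> the integrability premise carries no information about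
    \<open>u\<close>, so the induction hypothesis cannot be invoked.\<close>
  proof (cases "c = 0")
    case True
    then show ?thesis
      using sin_approx_cmult[OF sin_approx_continuous[OF sets \<open>finite_measure M\<close> \<open>p > 0\<close> D
          continuous_on_const], of 0] by simp
  next
    case False
    have "integrable M (\<lambda>x. \<bar>u x\<bar> powr p)"
      using mult.prems False by (simp add: abs_mult powr_mult)
    then show ?thesis using mult.IH sin_approx_cmult by blast
  qed
next
  case (add u v)
  \<comment> \<open>Both summands are nonnegative, hence each is dominated by the sum.\<close>
  have "integrable M (\<lambda>x. \<bar>u x\<bar> powr p)" "integrable M (\<lambda>x. \<bar>v x\<bar> powr p)"
    using add.hyps \<open>p > 0\<close>
    by (auto intro!: Bochner_Integration.integrable_bound[OF add.prems] AE_I2 powr_mono2)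
  then show ?case
    using add \<open>p > 0\<close> by (intro sin_approx_add[OF sets]) auto
next
  case (seq U)
  note [measurable] = seq.hyps(1) \<open>u \<in> borel_measurable M\<close>
  have le: "U i x \<le> u x" if "x \<in> space M" for i x
    using seq.hyps(3,4) that by (intro incseq_le) (auto simp: incseq_def le_fun_def)
  \<comment> \<open>Since 0 \<le> \<open>U i\<close> \<le> \<open>u\<close>, the difference also
    lies between 0 and \<open>u\<close>. Thus the p-th power of \<open>u\<close> serves as the
    dominating function.\<close>
  have dom: "AE x in M. norm (\<bar>u x - U i x\<bar> powr p) \<le> \<bar>u x\<bar> powr p" for i
    using le seq.hyps(2) \<open>p > 0\<close>
    by (auto intro!: AE_I2 powr_mono2 intro: order.trans[OF _ abs_ge_self])
  have int: "integrable M (\<lambda>x. \<bar>u x - U i x\<bar> powr p)" for i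
    by (rule Bochner_Integration.integrable_bound[OF seq.prems]) (use dom[of i] in auto)
  have "(\<lambda>i. LINT x|M. \<bar>u x - U i x\<bar> powr p) \<longlonglongrightarrow> (LINT x|M. 0)"
  proof (rule integral_dominated_convergence[OF _ _ seq.prems _ dom])
    show "AE x in M. (\<lambda>i. \<bar>u x - U i x\<bar> powr p) \<longlonglongrightarrow> 0"
    proof (rule AE_I2)
      fix x assume "x \<in> space M"
      then have "(\<lambda>i. \<bar>u x - U i x\<bar>) \<longlonglongrightarrow> \<bar>u x - u x\<bar>"
        by (intro tendsto_intros seq.hyps(4))
      then show "(\<lambda>i. \<bar>u x - U i x\<bar> powr p) \<longlonglongrightarrow> 0"
        using tendsto_powr'[OF _ tendsto_const[of p], of "\<lambda>i. \<bar>u x - U i x\<bar>" 0 sequentially] \<open>p > 0\<close>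
        by simp
    qed
  qed auto
  then have lim: "(\<lambda>i. LINT x|M. \<bar>u x - U i x\<bar> powr p) \<longlonglongrightarrow> 0" by simp
  show ?case
  proof (rule sin_approx_limit[OF sets])
    fix e :: real assume "e > 0"
    then obtain i where i: "(LINT x|M. \<bar>u x - U i x\<bar> powr p) < e"
      using eventually_happens'[OF sequentially_bot order_tendstoD(2)[OF lim]] by blast
    have "integrable M (\<lambda>x. \<bar>U i x\<bar> powr p)"
      by (rule Bochner_Integration.integrable_bound[OF seq.prems])
        (use le seq.hyps(2) \<open>p > 0\<close> in
          \<open>auto intro!: AE_I2 powr_mono2 intro: order.trans[OF _ abs_ge_self]\<close>)
    then show "\<exists>g. g \<in> borel_measurable M \<and> sin_approx M p g \<and>
        integrable M (\<lambda>x. \<bar>u x - g x\<bar> powr p) \<and> (LINT x|M. \<bar>u x - g x\<bar> powr p) < e"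
      using seq.IH[of i] int[of i] i by (intro exI[of _ "U i"]) auto
  qed (use \<open>p > 0\<close> in auto)
qed

text \<open>Positive and negative parts are both dominated by the absolute value of
  \<open>u\<close>. The generality in \<open>M\<close> and \<open>p\<close> is exploited twice: for
  the given measure, and for a weighted measure with exponent 1.\<close>

lemma sin_approx_Lp:
  assumes sets: "sets M = sets borel" and "finite_measure M" and "p > 0"
    and D: "compact D" "AE x in M. x \<in> D"
    and u: "u \<in> borel_measurable M" "integrable M (\<lambda>x. \<bar>u x\<bar> powr p)"
  shows "sin_approx M p u"
proof -
  note [measurable] = u(1)
  have "integrable M (\<lambda>x. \<bar>max 0 (u x)\<bar> powr p)" "integrable M (\<lambda>x. \<bar>max 0 (- u x)\<bar> powr p)"
    by (rule Bochner_Integration.integrable_bound[OF u(2)];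
        use \<open>p > 0\<close> in \<open>auto intro!: AE_I2 powr_mono2\<close>)+
  then have "sin_approx M p (\<lambda>x. max 0 (u x))" "sin_approx M p (\<lambda>x. max 0 (- u x))"
    by (auto intro!: sin_approx_nonneg[OF sets \<open>finite_measure M\<close> \<open>p > 0\<close> D])
  then have "sin_approx M p (\<lambda>x. max 0 (u x) + - 1 * max 0 (- u x))"
    using \<open>p > 0\<close> by (intro sin_approx_add[OF sets] sin_approx_cmult) auto
  also have "(\<lambda>x. max 0 (u x) + - 1 * max 0 (- u x)) = u"
    by (auto simp: max_def)
  finally show ?thesis .
qed


section \<open>Pairing integrable functions with sine networks\<close>

lemma integrable_sin_net_mult:
  fixes f u :: "'z::euclidean_space \<Rightarrow> real"
  assumes sets: "sets M = sets borel" and "sin_net f" "integrable M u"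
  shows "integrable M (\<lambda>x. f x * u x)"
proof -
  obtain B where B: "B \<ge> 0" "\<And>x. norm (f x) \<le> B" using sin_net_bounded[OF assms(2)] by blast
  have [measurable]: "f \<in> borel_measurable M" "u \<in> borel_measurable M"
    using sin_net_borel_measurable[OF assms(2)] assms(3)
    by (auto simp: measurable_cong_sets[OF sets refl])
  have "norm (f x * u x) \<le> norm (B * u x)" for x
    using B by (auto simp: abs_mult intro!: mult_right_mono)
  then show ?thesis
    by (intro Bochner_Integration.integrable_bound[OF integrable_mult_right[OF assms(3), of B]])
      auto
qed

text \<open>The idea is to approximate \<open>sgn \<circ> u\<close> in \<open>L\<^sup>1\<close> of the measure with density \<open>\<bar>u\<bar>\<close>.\<close>

lemma sin_net_integral_nonzero:
  assumes sets: "sets M = sets borel"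
    and D: "compact D" "AE x in M. x \<in> D"
    and u: "integrable M u" "\<not> (AE x in M. u x = (0::real))"
  obtains \<phi> where "sin_net \<phi>" "(LINT x|M. \<phi> x * u x) \<noteq> 0"
proof -
  define N where "N = density M (\<lambda>x. \<bar>u x\<bar>)"
  have [measurable]: "u \<in> borel_measurable M" using u(1) by auto
  have setsN: "sets N = sets borel" by (simp add: N_def sets)
  have "emeasure N (space N) = (\<integral>\<^sup>+ x. ennreal \<bar>u x\<bar> \<partial>M)"
    by (simp add: N_def emeasure_density cong: nn_integral_cong)
  also have "\<dots> < \<infinity>" using u(1) by (simp add: integrable_iff_bounded)
  finally have fin: "finite_measure N" by (intro finite_measureI) auto
  interpret finite_measure N by fact
  have DN: "AE x in N. x \<in> D"
    unfolding N_def by (subst AE_density) (use D(2) in auto)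
  have sm: "(\<lambda>x. sgn (u x)) \<in> borel_measurable N"
    by (simp add: N_def)
  have "integrable N (\<lambda>x. \<bar>sgn (u x)\<bar> powr 1)"
    by (rule integrable_const_bound[where B = 1]) (use sm in \<open>auto simp: sgn_if\<close>)
  then have approx: "sin_approx N 1 (\<lambda>x. sgn (u x))"
    by (intro sin_approx_Lp[OF setsN fin _ D(1) DN sm]) auto
  have pos: "(LINT x|M. \<bar>u x\<bar>) > 0"
  proof -
    have "(LINT x|M. \<bar>u x\<bar>) \<noteq> 0"
      using u by (subst integral_nonneg_eq_0_iff_AE) auto
    then show ?thesis by (simp add: less_le)
  qed
  \<comment> \<open>The threshold is the integral of \<open>u * sgn u\<close>. Replacing
    \<open>sgn u\<close> by \<phi> changes that integral by less than its own value, so the result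
    cannot be 0.\<close>
  obtain \<phi> where \<phi>: "sin_net \<phi>" "(LINT x|N. \<bar>sgn (u x) - \<phi> x\<bar> powr 1) < (LINT x|M. \<bar>u x\<bar>)"
    using approx pos unfolding sin_approx_def by blast
  have [measurable]: "\<phi> \<in> borel_measurable M"
    using sin_net_borel_measurable[OF \<phi>(1)] by (simp add: measurable_cong_sets[OF sets refl])
  have int: "integrable M (\<lambda>x. \<phi> x * u x)"
    by (rule integrable_sin_net_mult[OF sets \<phi>(1) u(1)])
  have eq: "u x * (sgn (u x) - \<phi> x) = \<bar>u x\<bar> - \<phi> x * u x" for x
    by (simp add: right_diff_distrib abs_sgn)
  have int': "integrable M (\<lambda>x. u x * (sgn (u x) - \<phi> x))"
    using int u(1) by (simp add: eq)
  have "(LINT x|N. \<bar>sgn (u x) - \<phi> x\<bar> powr 1) = (LINT x|M. \<bar>u x * (sgn (u x) - \<phi> x)\<bar>)"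
    unfolding N_def by (subst integral_real_density) (auto simp: abs_mult)
  moreover have "(LINT x|M. u x * (sgn (u x) - \<phi> x)) \<le> (LINT x|M. \<bar>u x * (sgn (u x) - \<phi> x)\<bar>)"
    using int' by (intro integral_mono) auto
  moreover have "(LINT x|M. u x * (sgn (u x) - \<phi> x)) = (LINT x|M. \<bar>u x\<bar>) - (LINT x|M. \<phi> x * u x)"
    using int u(1) by (simp add: eq)
  ultimately have "(LINT x|M. \<phi> x * u x) \<noteq> 0" using \<phi>(2) by linarith
  then show thesis using that \<phi>(1) by blast
qed

section \<open>Separable kernels\<close>

text \<open>The bound \<bar>t\<bar> \<le> 1 + \<open>\<bar>t\<bar> powr p\<close> and the finite
  mass put \<open>L^p\<close> inside \<open>L^1\<close>, so that integrals of sine networks against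
  \<open>u\<close> are meaningful.\<close>

lemma integrable_of_abs_powr:
  fixes u :: "'x \<Rightarrow> real"
  assumes "finite_measure M" "p \<ge> 1" "u \<in> borel_measurable M" "integrable M (\<lambda>x. \<bar>u x\<bar> powr p)"
  shows "integrable M u"
proof -
  interpret finite_measure M by fact
  have "\<bar>t\<bar> \<le> 1 + \<bar>t\<bar> powr p" for t :: real
  proof (cases "\<bar>t\<bar> \<le> 1")
    case False
    then have "\<bar>t\<bar> powr 1 \<le> \<bar>t\<bar> powr p" using assms(2) by (intro powr_mono) auto
    then show ?thesis by simp
  qed (use powr_ge_zero[of "\<bar>t\<bar>" p] in linarith)
  then have "AE x in M. norm (u x) \<le> norm (1 + \<bar>u x\<bar> powr p)"
    by (auto intro!: AE_I2 order.trans[OF _ abs_ge_self])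
  then show ?thesis
    by (rule Bochner_Integration.integrable_bound[rotated 2]) (use assms in auto)
qed

lemma separable_kernel_approx:
  fixes u :: "'z::euclidean_space \<Rightarrow> real"
  assumes sets: "sets M = sets borel" and "finite_measure M" and "p \<ge> 1"
    and D: "compact D" "AE x in M. x \<in> D"
    and u: "u \<in> borel_measurable M" "integrable M (\<lambda>x. \<bar>u x\<bar> powr p)" and "e > 0"
  shows "\<exists>\<psi> \<phi>. sin_net \<psi> \<and> sin_net \<phi> \<and>
    integrable M (\<lambda>x. \<bar>\<psi> x * (LINT y|M. \<phi> y * u y) - u x\<bar> powr p) \<and>
    (LINT x|M. \<bar>\<psi> x * (LINT y|M. \<phi> y * u y) - u x\<bar> powr p) < e"
proof (cases "AE x in M. u x = 0")
  case True
  \<comment> \<open>Here every integral against \<open>u\<close> vanishes and division is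
    impossible, but the zero kernel already reproduces \<open>u\<close> almost everywhere.\<close>
  have "(LINT x|M. \<bar>0 * (LINT y|M. 0 * u y) - u x\<bar> powr p) = (LINT x|M. 0)"
    by (rule integral_cong_AE) (use u(1) True in auto)
  then show ?thesis
    using u \<open>e > 0\<close> by (intro exI[of _ "\<lambda>_. 0"]) (simp add: sin_net_const)
next
  case False
  have "integrable M u" by (rule integrable_of_abs_powr) fact+
  then obtain \<phi> where \<phi>: "sin_net \<phi>" "(LINT x|M. \<phi> x * u x) \<noteq> 0"
    using sin_net_integral_nonzero[OF sets D _ False] by blast
  obtain s where s: "sin_net s" "integrable M (\<lambda>x. \<bar>u x - s x\<bar> powr p)"
    "(LINT x|M. \<bar>u x - s x\<bar> powr p) < e"
    using sin_approx_Lp[OF sets \<open>finite_measure M\<close> _ D u] \<open>p \<ge> 1\<close> \<open>e > 0\<close>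
    unfolding sin_approx_def by auto
  let ?c = "LINT x|M. \<phi> x * u x"
  show ?thesis
    \<comment> \<open>Dividing the approximant \<open>s\<close> by \<open>?c\<close> cancels the
      factor that the integral over y contributes.\<close>
    using s \<phi> sin_net_cmult[OF s(1), of "1 / ?c"]
    by (intro exI[of _ "\<lambda>x. 1 / ?c * s x"] exI[of _ \<phi>]) (simp add: abs_minus_commute)
qed

text \<open>The norm is at most the dimension times the largest component, whose p-th power is one
  term of the sum. This reduces the vector-valued error to the component errors.\<close>

lemma norm_vec_powr_le:
  fixes w :: "real ^ 'n"
  assumes "p \<ge> 0"
  shows "norm w powr p \<le> real CARD('n) powr p * (\<Sum>k\<in>UNIV. \<bar>w $ k\<bar> powr p)"
proof -
  obtain k where k: "\<bar>w $ j\<bar> \<le> \<bar>w $ k\<bar>" for j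
  proof -
    have "Max (range (\<lambda>j. \<bar>w $ j\<bar>)) \<in> range (\<lambda>j. \<bar>w $ j\<bar>)" by (intro Max_in) auto
    then obtain k where "Max (range (\<lambda>j. \<bar>w $ j\<bar>)) = \<bar>w $ k\<bar>" by (rule rangeE)
    then show thesis using that by (metis Max_ge finite finite_imageI rangeI)
  qed
  have "norm w \<le> (\<Sum>j\<in>UNIV. \<bar>w $ j\<bar>)" by (rule norm_le_l1_cart)
  also have "\<dots> \<le> real CARD('n) * \<bar>w $ k\<bar>" using k by (intro sum_bounded_above) auto
  finally have "norm w powr p \<le> (real CARD('n) * \<bar>w $ k\<bar>) powr p"
    using assms by (intro powr_mono2) auto
  also have "\<dots> = real CARD('n) powr p * \<bar>w $ k\<bar> powr p" by (simp add: powr_mult)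
  also have "\<bar>w $ k\<bar> powr p \<le> (\<Sum>k\<in>UNIV. \<bar>w $ k\<bar> powr p)"
    by (rule member_le_sum) auto
  finally show ?thesis by (simp add: mult_left_mono)
qed

section \<open>Assembling the vector-valued network from its components\<close>

lemma sum_axis_nth: "(\<Sum>k\<in>UNIV. f k *\<^sub>R axis k (1::real)) $ j = f j"
  by (simp add: axis_def if_distrib[of "\<lambda>x. _ * x"] cong: if_cong)

theorem theorem3p1:
  fixes D :: "(real ^ 'd) set"
    and \<mu> :: "(real ^ 'd) measure"
    and p :: real
    and \<nu> :: "(real ^ 'd \<Rightarrow> real ^ 'v) measure"
    and A :: "(real ^ 'd \<Rightarrow> real ^ 'a) set"
    and N :: "(real ^ 'd \<Rightarrow> real ^ 'a) \<Rightarrow> real"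
    and a :: "real ^ 'd \<Rightarrow> real ^ 'a"
    and v :: "real ^ 'd \<Rightarrow> real ^ 'v"
    and \<epsilon> :: real
  assumes "compact D"
    and "sets \<mu> = sets borel" and "prob_space \<mu>" and "AE x in \<mu>. x \<in> D"
    and "1 < p"
    and "sets \<nu> = sets (Lp_borel \<mu> D p)" and "prob_space \<nu>"
    and "integrable \<nu> (Lp_norm \<mu> D p)"
    and "separable_banach_fun_space D A N" and "a \<in> A"
    and "v \<in> Lp_fun \<mu> D p" and "\<epsilon> > 0"
  shows "\<exists>h :: (real ^ 'd) \<times> (real ^ 'd) \<times> (real ^ 'a) \<Rightarrow> real ^ 'v.
    tw_network h \<and>
    (\<forall>x\<in>D. set_integrable \<mu> D (kernel_integrand h a v x)) \<and>
    kernel_operator \<mu> D h a v \<in> Lp_fun \<mu> D p \<and>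
    Lp_norm \<mu> D p (\<lambda>x. kernel_operator \<mu> D h a v x - v x) \<le> \<epsilon>"
proof -
  interpret prob_space \<mu> by fact
  note sets = \<open>sets \<mu> = sets borel\<close> and D = \<open>compact D\<close> \<open>AE x in \<mu>. x \<in> D\<close>
  have [measurable]: "D \<in> sets \<mu>" using sets D(1) by (simp add: borel_compact)
  \<comment> \<open>Cutting \<open>v\<close> off outside \<open>D\<close> turns set integrals into
    integrals over all of \<mu> and gives a function that is Borel measurable everywhere.\<close>
  define u where "u = (\<lambda>x. indicator D x *\<^sub>R v x)"
  have u[measurable]: "u \<in> borel_measurable \<mu>"
    and "integrable \<mu> (\<lambda>x. indicator D x *\<^sub>R norm (v x) powr p)"
    using \<open>v \<in> Lp_fun \<mu> D p\<close>
    by (auto simp: Lp_fun_def set_borel_measurable_def set_integrable_def u_def)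
  moreover have "indicator D x *\<^sub>R norm (v x) powr p = norm (u x) powr p" for x
    using \<open>1 < p\<close> by (auto simp: u_def indicator_def)
  ultimately have uint: "integrable \<mu> (\<lambda>x. norm (u x) powr p)" by simp
  have ukm[measurable]: "(\<lambda>x. u x $ k) \<in> borel_measurable \<mu>" for k
    by (rule borel_measurable_continuous_on[OF _ u]) (intro continuous_intros)
  have ukp: "integrable \<mu> (\<lambda>x. \<bar>u x $ k\<bar> powr p)" for k
    by (rule Bochner_Integration.integrable_bound[OF uint])
      (use \<open>1 < p\<close> in \<open>auto intro!: AE_I2 powr_mono2 component_le_norm_cart\<close>)
  define C where "C = real CARD('v) powr p"
  \<comment> \<open>\<open>C\<close> is the constant of \<open>norm_vec_powr_le\<close>. Component
    errors below \<open>e\<close> then give a total of at most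
    \<open>\<epsilon> powr p\<close>.\<close>
  define e where "e = \<epsilon> powr p / (C * real CARD('v))"
  have "C > 0" by (simp add: C_def)
  then have "e > 0" using \<open>\<epsilon> > 0\<close> by (simp add: e_def)
  have "\<forall>k. \<exists>\<psi> \<phi>. sin_net \<psi> \<and> sin_net \<phi> \<and>
    integrable \<mu> (\<lambda>x. \<bar>\<psi> x * (LINT y|\<mu>. \<phi> y * u y $ k) - u x $ k\<bar> powr p) \<and>
    (LINT x|\<mu>. \<bar>\<psi> x * (LINT y|\<mu>. \<phi> y * u y $ k) - u x $ k\<bar> powr p) < e"
    using \<open>1 < p\<close> \<open>e > 0\<close> finite_measure_axioms
    by (intro allI separable_kernel_approx[OF sets _ _ D] ukm ukp) auto
  then obtain \<psi> \<phi> where sin: "\<And>k. sin_net (\<psi> k)" "\<And>k. sin_net (\<phi> k)"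
    and int: "\<And>k. integrable \<mu> (\<lambda>x. \<bar>\<psi> k x * (LINT y|\<mu>. \<phi> k y * u y $ k) - u x $ k\<bar> powr p)"
    and small: "\<And>k. (LINT x|\<mu>. \<bar>\<psi> k x * (LINT y|\<mu>. \<phi> k y * u y $ k) - u x $ k\<bar> powr p) < e"
    unfolding choice_iff by blast
  define c where "c k = (LINT y|\<mu>. \<phi> k y * u y $ k)" for k
  \<comment> \<open>At z = (x - y, x, a y), \<open>fst (snd z)\<close> is x and
    \<open>fst (snd z) - fst z\<close> is y. Summing over \<open>axis k 1\<close> keeps the vector
    within the closure rules of \<open>sin_net\<close>.\<close>
  define h :: "(real ^ 'd) \<times> (real ^ 'd) \<times> (real ^ 'a) \<Rightarrow> real ^ 'v" where
    "h z = (\<Sum>k\<in>UNIV. (\<psi> k (fst (snd z)) * \<phi> k (fst (snd z) - fst z)) *\<^sub>R axis k 1)" for z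
  have "tw_network h"
    unfolding h_def[abs_def]
    by (intro tw_network_sin_net sin_net_sum sin_net_scaleR_const sin_net_mult
        sin_net_compose_linear[OF sin(1)] sin_net_compose_linear[OF sin(2)]
        bounded_linear.linear bounded_linear_intros) auto
  \<comment> \<open>The indicator of \<open>D\<close> is absorbed into \<open>u\<close>, so the
    identity holds for all x and y.\<close>
  have integrand: "indicator D y *\<^sub>R kernel_integrand h a v x y =
      (\<Sum>k\<in>UNIV. (\<psi> k x * (\<phi> k y * u y $ k)) *\<^sub>R axis k 1)" for x y
    by (simp add: kernel_integrand_def h_def sum_axis_nth u_def vec_eq_iff del: sum_component)
  have int\<phi>: "integrable \<mu> (\<lambda>y. \<phi> k y * u y $ k)" for k
    using integrable_of_abs_powr[OF finite_measure_axioms _ ukm ukp] \<open>1 < p\<close>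
    by (intro integrable_sin_net_mult[OF sets sin(2)]) simp
  have "set_integrable \<mu> D (kernel_integrand h a v x)" for x
    unfolding set_integrable_def integrand
    by (intro Bochner_Integration.integrable_sum integrable_scaleR_left integrable_mult_right int\<phi>)
  moreover have op: "kernel_operator \<mu> D h a v = (\<lambda>x. \<Sum>k\<in>UNIV. (\<psi> k x * c k) *\<^sub>R axis k 1)"
    unfolding kernel_operator_def set_lebesgue_integral_def integrand c_def
    by (subst Bochner_Integration.integral_sum) (use int\<phi> in auto)
  moreover have "kernel_operator \<mu> D h a v \<in> Lp_fun \<mu> D p"
  proof -
    \<comment> \<open>As a function of x the output is itself a sine network, hence bounded and
      measurable, and so in \<open>L^p\<close> of a probability measure.\<close>
    have "sin_net (kernel_operator \<mu> D h a v)"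
      unfolding op using sin(1)
      by (intro sin_net_sum sin_net_scaleR_const sin_net_mult sin_net_const) auto
    then obtain B where B: "\<And>x. norm (kernel_operator \<mu> D h a v x) \<le> B"
      and [measurable]: "kernel_operator \<mu> D h a v \<in> borel_measurable \<mu>"
      using sin_net_bounded sin_net_borel_measurable measurable_cong_sets[OF sets refl] by metis
    have "integrable \<mu> (\<lambda>x. norm (kernel_operator \<mu> D h a v x) powr p)"
      by (rule integrable_const_bound[where B = "B powr p"])
        (use B \<open>1 < p\<close> in \<open>auto intro!: AE_I2 powr_mono2\<close>)
    then show ?thesis
      by (auto simp: Lp_fun_def set_borel_measurable_def set_integrable_def
          intro!: integrable_mult_indicator[where 'b = real, simplified])
  qed
  moreover have "Lp_norm \<mu> D p (\<lambda>x. kernel_operator \<mu> D h a v x - v x) \<le> \<epsilon>"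
  proof -
    let ?S = "\<lambda>x. C * (\<Sum>k\<in>UNIV. \<bar>\<psi> k x * c k - u x $ k\<bar> powr p)"
    \<comment> \<open>On \<open>D\<close> the functions \<open>v\<close> and \<open>u\<close> agree;
      off \<open>D\<close> the left side is 0.\<close>
    have le: "indicator D x *\<^sub>R norm (kernel_operator \<mu> D h a v x - v x) powr p \<le> ?S x" for x
    proof (cases "x \<in> D")
      case True
      then have "v x = u x" by (simp add: u_def)
      then show ?thesis
        using True norm_vec_powr_le[of p "kernel_operator \<mu> D h a v x - u x"] \<open>1 < p\<close>
        by (simp add: op sum_axis_nth C_def del: sum_component)
    next
      case False
      then show ?thesis using \<open>C > 0\<close> by (simp add: sum_nonneg)
    qed
    have intS: "integrable \<mu> ?S" using int by (auto simp: c_def)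
    have "(LINT x:D|\<mu>. norm (kernel_operator \<mu> D h a v x - v x) powr p) \<le> (LINT x|\<mu>. ?S x)"
      unfolding set_lebesgue_integral_def
      by (rule integral_mono'[OF intS le]) (use \<open>C > 0\<close> in \<open>simp add: sum_nonneg\<close>)
    also have "\<dots> = C * (\<Sum>k\<in>UNIV. LINT x|\<mu>. \<bar>\<psi> k x * c k - u x $ k\<bar> powr p)"
      using int by (simp add: c_def)
    also have "\<dots> \<le> C * (real CARD('v) * e)"
      using small \<open>C > 0\<close> by (intro mult_left_mono sum_bounded_above) (auto simp: c_def less_imp_le)
    also have "\<dots> = \<epsilon> powr p" using \<open>C > 0\<close> by (simp add: e_def)
    finally have "(LINT x:D|\<mu>. norm (kernel_operator \<mu> D h a v x - v x) powr p) \<le> \<epsilon> powr p" .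
    then have "Lp_norm \<mu> D p (\<lambda>x. kernel_operator \<mu> D h a v x - v x) \<le> (\<epsilon> powr p) powr (1 / p)"
      unfolding Lp_norm_def using \<open>1 < p\<close>
      by (intro powr_mono2) (auto simp: set_lebesgue_integral_def)
    also have "\<dots> = \<epsilon>" using \<open>1 < p\<close> \<open>\<epsilon> > 0\<close> by (simp add: powr_powr)
    finally show ?thesis .
  qed
  ultimately show ?thesis using \<open>tw_network h\<close> by blast
qed

end
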